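(* Let $a,b,c$ be commuting indeterminates and let $D$ be the derivation of $\mathbb{Q}[a,b,c]$ determined by $D(a)=a^2b$, $D(b)=b^2c$, $D(c)=bc^2$. For $1\le k\le n$ let $R(n,k)=k!\binom{2n-k-1}{k-1}(2n-2k-1)!!$. Then for all $n\ge 1$, $$D^n(a)=ab^{n}\sum_{k=1}^{n}R(n,k)a^{k}c^{n-k}.$$
   Context: $D$ is the formal derivative of the context-free grammar $\{a\rightarrow a^2b, b\rightarrow b^2c, c\rightarrow bc^2\}$, i.e. a linear map satisfying the Leibniz rule $D(uv)=D(u)v+uD(v)$. Double factorials: $(2m-1)!!=1\cdot3\cdots(2m-1)$, with $(-1)!!=1$. *)

theory Defs
  imports Complex_Main "HOL-Library.Poly_Mapping"
begin

text \<open>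
  The ring \<open>\<rat>[a, b, c]\<close>: a monomial is a finitely supported exponent vector
  \<open>indet \<Rightarrow>\<^sub>0 nat\<close>, a polynomial is a finitely supported coefficient function on monomials, and
  multiplication is the convolution product of \<open>HOL-Library.Poly_Mapping\<close>.
\<close>

datatype indet = IndA | IndB | IndC

type_synonym qpoly = "(indet \<Rightarrow>\<^sub>0 nat) \<Rightarrow>\<^sub>0 rat"

definition const :: "rat \<Rightarrow> qpoly" where
  "const q = Poly_Mapping.single 0 q"

definition var :: "indet \<Rightarrow> qpoly" where
  "var i = Poly_Mapping.single (Poly_Mapping.single i 1) 1"

abbreviation "va \<equiv> var IndA"
abbreviation "vb \<equiv> var IndB"
abbreviation "vc \<equiv> var IndC"

definition derivation :: "(qpoly \<Rightarrow> qpoly) \<Rightarrow> bool" where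
  "derivation D \<longleftrightarrow>
     (\<forall>u v. D (u + v) = D u + D v) \<and>
     (\<forall>q u. D (const q * u) = const q * D u) \<and>
     (\<forall>u v. D (u * v) = D u * v + u * D v)"

text \<open>\<open>odd_dfact m\<close> is the double factorial \<open>(2m - 1)!!\<close>, with \<open>(-1)!! = 1\<close> for \<open>m = 0\<close>.\<close>

definition odd_dfact :: "nat \<Rightarrow> nat" where
  "odd_dfact m = (\<Prod>i = 1..m. 2 * i - 1)"

text \<open>
  For \<open>1 \<le> k \<le> n\<close> no subtraction below is truncated, and the last factor is \<open>(2n - 2k - 1)!!\<close>.
\<close>

definition R :: "nat \<Rightarrow> nat \<Rightarrow> nat" where
  "R n k = fact k * ((2 * n - k - 1) choose (k - 1)) * odd_dfact (n - k)"

text \<open>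
  The values of a derivation on the indeterminates can be prescribed arbitrarily and determine it.
\<close>

lemma UNIV_indet: "UNIV = {IndA, IndB, IndC}"
  using indet.exhaust by auto

instance indet :: finite
  by standard (simp add: UNIV_indet)

lemma qpoly_decompose:
  "(p :: qpoly) = (\<Sum>m\<in>Poly_Mapping.keys p. Poly_Mapping.single m (Poly_Mapping.lookup p m))"
proof (rule poly_mapping_eqI)
  fix k
  show "Poly_Mapping.lookup p k = Poly_Mapping.lookup (\<Sum>m\<in>Poly_Mapping.keys p. Poly_Mapping.single m (Poly_Mapping.lookup p m)) k"
    by (cases "k \<in> Poly_Mapping.keys p")
       (auto simp: lookup_sum lookup_single when_def in_keys_iff)
qed

lemma qpoly_induct [case_names zero single add]:
  fixes p :: qpoly
  assumes "P 0" and "\<And>m q. P (Poly_Mapping.single m q)" and "\<And>p q. P p \<Longrightarrow> P q \<Longrightarrow> P (p + q)"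
  shows "P p"
proof -
  have "P (\<Sum>m\<in>S. Poly_Mapping.single m (Poly_Mapping.lookup p m))" if "finite S" for S
    using that by (induction S) (simp_all add: assms)
  then show ?thesis
    using qpoly_decompose [of p] by (metis finite_keys)
qed

definition dmon :: "(indet \<Rightarrow> qpoly) \<Rightarrow> (indet \<Rightarrow>\<^sub>0 nat) \<Rightarrow> qpoly" where
  "dmon f m = (\<Sum>i\<in>UNIV.
     Poly_Mapping.single (m - Poly_Mapping.single i 1) (of_nat (Poly_Mapping.lookup m i)) * f i)"

definition dext :: "(indet \<Rightarrow> qpoly) \<Rightarrow> qpoly \<Rightarrow> qpoly" where
  "dext f p = (\<Sum>m\<in>Poly_Mapping.keys p. const (Poly_Mapping.lookup p m) * dmon f m)"

lemma dext_superset: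
  assumes "finite S" "Poly_Mapping.keys p \<subseteq> S"
  shows "dext f p = (\<Sum>m\<in>S. const (Poly_Mapping.lookup p m) * dmon f m)"
  unfolding dext_def using assms
  by (intro sum.mono_neutral_left) (auto simp: const_def in_keys_iff)

lemma dext_add: "dext f (p + q) = dext f p + dext f q"
proof -
  let ?S = "Poly_Mapping.keys p \<union> Poly_Mapping.keys q"
  have "finite ?S" "Poly_Mapping.keys (p + q) \<subseteq> ?S"
    by (simp_all add: keys_add)
  then show ?thesis
    by (simp add: dext_superset [of ?S] lookup_add const_def single_add distrib_right sum.distrib)
qed

lemma dext_single: "dext f (Poly_Mapping.single m q) = const q * dmon f m"
  by (subst dext_superset [of "{m}"]) auto

lemma dext_zero: "dext f 0 = 0"
  by (simp add: dext_def)

lemma single_shift: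
  fixes m m' :: "indet \<Rightarrow>\<^sub>0 nat"
  shows "Poly_Mapping.single (m + m' - Poly_Mapping.single i 1) (of_nat (Poly_Mapping.lookup m' i) :: rat) =
    Poly_Mapping.single m 1 *
      Poly_Mapping.single (m' - Poly_Mapping.single i 1) (of_nat (Poly_Mapping.lookup m' i))"
proof (cases "Poly_Mapping.lookup m' i = 0")
  case False
  then have "m + m' - Poly_Mapping.single i 1 = m + (m' - Poly_Mapping.single i 1)"
    by (intro poly_mapping_eqI) (auto simp: lookup_add lookup_minus lookup_single when_def)
  then show ?thesis by (simp add: mult_single)
qed simp

lemma dmon_add:
  "dmon f (m + m') = dmon f m * Poly_Mapping.single m' 1 + Poly_Mapping.single m 1 * dmon f m'"
proof -
  have "Poly_Mapping.single (m + m' - Poly_Mapping.single i 1)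
      (of_nat (Poly_Mapping.lookup (m + m') i) :: rat) * f i =
    Poly_Mapping.single (m - Poly_Mapping.single i 1) (of_nat (Poly_Mapping.lookup m i)) * f i
      * Poly_Mapping.single m' 1 +
    Poly_Mapping.single m 1 *
      (Poly_Mapping.single (m' - Poly_Mapping.single i 1) (of_nat (Poly_Mapping.lookup m' i)) * f i)" for i
    using single_shift [of m m' i] single_shift [of m' m i]
    by (simp add: lookup_add single_add algebra_simps)
  then show ?thesis
    by (simp add: dmon_def sum.distrib sum_distrib_left sum_distrib_right)
qed

lemma single_const: "Poly_Mapping.single m q = const q * Poly_Mapping.single m 1"
  by (simp add: const_def mult_single)

lemma dext_mult: "dext f (p * q) = dext f p * q + p * dext f q"
proof (induction p rule: qpoly_induct)
  case (single m x)
  show ?case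
  proof (induction q rule: qpoly_induct)
    case (single m' y)
    have "dext f (Poly_Mapping.single m x * Poly_Mapping.single m' y) =
        const x * const y * dmon f (m + m')"
      by (simp add: mult_single dext_single const_def)
    also have "\<dots> = const x * dmon f m * (const y * Poly_Mapping.single m' 1) +
        const x * Poly_Mapping.single m 1 * (const y * dmon f m')"
      by (simp add: dmon_add algebra_simps)
    finally show ?case
      by (simp only: dext_single flip: single_const)
  qed (simp_all add: dext_zero dext_add algebra_simps)
qed (simp_all add: dext_zero dext_add algebra_simps)

lemma derivation_dext: "derivation (dext f)"
proof -
  have "dext f (const q) = 0" for q
    by (simp add: const_def dext_single dmon_def)
  then show ?thesis
    by (auto simp: derivation_def dext_add dext_mult)
qed

lemma dext_var: "dext f (var i) = f i"
proof -
  have "dmon f (Poly_Mapping.single i 1) = (\<Sum>j\<in>UNIV. if j = i then f i else 0)"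
    unfolding dmon_def by (intro sum.cong) (auto simp: lookup_single when_def)
  then show ?thesis
    by (simp add: var_def dext_single const_def)
qed

lemma derivation_eqI:
  assumes D: "derivation D" and E: "derivation E" and eq: "\<And>i. D (var i) = E (var i)"
  shows "D = E"
proof
  fix p
  have add: "D (u + v) = D u + D v" "E (u + v) = E u + E v"
    and scale: "D (const q * u) = const q * D u" "E (const q * u) = const q * E u"
    and leib: "D (u * v) = D u * v + u * D v" "E (u * v) = E u * v + u * E v" for u v q
    using D E by (auto simp: derivation_def)
  have zero: "D 0 = 0" "E 0 = 0" using add [of 0 0] by simp_all
  have one: "D 1 = 0" "E 1 = 0" using leib [of 1 1] by simp_all
  have pow: "D (Poly_Mapping.single (Poly_Mapping.single i k) 1) =
    E (Poly_Mapping.single (Poly_Mapping.single i k) 1)" for i k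
  proof (induction k)
    case (Suc k)
    have "(Poly_Mapping.single (Poly_Mapping.single i (Suc k)) 1 :: qpoly) =
        var i * Poly_Mapping.single (Poly_Mapping.single i k) 1"
      by (simp add: var_def mult_single flip: single_add)
    then show ?case by (simp only: leib Suc eq)
  qed (simp add: one)
  have "D (Poly_Mapping.single m 1) = E (Poly_Mapping.single m 1)" for m
  proof -
    have "m = Poly_Mapping.single IndA (Poly_Mapping.lookup m IndA) + Poly_Mapping.single IndB (Poly_Mapping.lookup m IndB)
        + Poly_Mapping.single IndC (Poly_Mapping.lookup m IndC)"
    proof (rule poly_mapping_eqI)
      fix i show "Poly_Mapping.lookup m i = Poly_Mapping.lookup (Poly_Mapping.single IndA (Poly_Mapping.lookup m IndA)
        + Poly_Mapping.single IndB (Poly_Mapping.lookup m IndB) + Poly_Mapping.single IndC (Poly_Mapping.lookup m IndC)) i"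
        by (cases i) (simp_all add: lookup_add lookup_single)
    qed
    then have "(Poly_Mapping.single m 1 :: qpoly) =
        Poly_Mapping.single (Poly_Mapping.single IndA (Poly_Mapping.lookup m IndA)) 1 *
        Poly_Mapping.single (Poly_Mapping.single IndB (Poly_Mapping.lookup m IndB)) 1 *
        Poly_Mapping.single (Poly_Mapping.single IndC (Poly_Mapping.lookup m IndC)) 1"
      by (simp add: mult_single)
    then show ?thesis by (simp only: leib pow)
  qed
  then have "D (Poly_Mapping.single m q) = E (Poly_Mapping.single m q)" for m q
    by (metis single_const scale)
  then show "D p = E p"
    by (induction p rule: qpoly_induct) (simp_all only: zero add)
qed

lemma derivation_ex1:
  "\<exists>!D. derivation D \<and> D va = fa \<and> D vb = fb \<and> D vc = fc"
proof (rule ex1I)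
  let ?f = "case_indet fa fb fc"
  show "derivation (dext ?f) \<and> dext ?f va = fa \<and> dext ?f vb = fb \<and> dext ?f vc = fc"
    by (simp add: derivation_dext dext_var)
  fix D assume D: "derivation D \<and> D va = fa \<and> D vb = fb \<and> D vc = fc"
  show "D = dext ?f"
  proof (rule derivation_eqI)
    fix i show "D (var i) = dext ?f (var i)"
      using D by (cases i) (simp_all add: dext_var)
  qed (use D derivation_dext in auto)
qed

end

theory Submission
  imports Defs
begin

text \<open>
  With \<open>t n k = a\<^sup>k\<^sup>+\<^sup>1 b\<^sup>n c\<^sup>n\<^sup>-\<^sup>k\<close> the Leibniz rule gives
  \<open>D (t n k) = (k + 1) t (n + 1) (k + 1) + (2n - k) t (n + 1) k\<close>. The theorem therefore
  follows from the recurrence \<open>R (n + 1) k = k R n (k - 1) + (2n - k) R n k\<close>, which reduces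
  by Pascal's rule to the absorption identity for binomial coefficients.
\<close>

lemma odd_dfact_Suc: "odd_dfact (Suc m) = (2 * m + 1) * odd_dfact m"
  by (simp add: odd_dfact_def)

lemma R_diag: "n \<ge> 1 \<Longrightarrow> R n n = fact n"
  by (simp add: R_def odd_dfact_def)

text \<open>The binomial coefficient has the truncated upper index \<open>n - 2\<close>, which is
  below its lower index \<open>n\<close>.\<close>

lemma R_above_diag: "n \<ge> 1 \<Longrightarrow> R n (Suc n) = 0"
  by (simp add: R_def)

text \<open>With \<open>m\<close> as the distance from the diagonal, no subtraction remains.\<close>

lemma R_eq: "R (Suc j + m) (Suc j) = fact (Suc j) * ((j + 2 * m) choose j) * odd_dfact m"
proof -
  have "2 * (Suc j + m) - Suc j - 1 = j + 2 * m" by simp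
  then show ?thesis by (simp add: R_def)
qed

text \<open>Trades the coefficient \<open>2 * n - Suc k\<close> of the recurrence, with
  \<open>n = Suc k + m\<close> and \<open>j = k\<close>, for the factor \<open>2 * m + 1\<close>
  that turns \<open>odd_dfact m\<close> into \<open>odd_dfact (Suc m)\<close>.\<close>

lemma absorption_odd:
  "(2 * m + 1) * ((j + 2 * m + 1) choose j) = (j + 2 * m + 1) * ((j + 2 * m) choose j)"
  using binomial_absorb_comp[of "j + 2 * m + 1" j] by (simp add: algebra_simps)

text \<open>The case distinction is needed because \<open>R n 0\<close> is not zero: \<open>k - 1\<close> is truncated.\<close>

lemma R_Suc_Suc:
  assumes "n \<ge> 1" "k \<le> n"
  shows "R (Suc n) (Suc k) = (if k = 0 then 0 else Suc k * R n k) + (2 * n - Suc k) * R n (Suc k)"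
proof (cases "k = n")
  \<comment> \<open>Here \<open>Suc k > n\<close>, so \<open>R_eq\<close> does not cover
    \<open>R n (Suc k)\<close>, which vanishes.\<close>
  case True
  then show ?thesis using assms by (simp add: R_diag R_above_diag)
next
  case False
  with assms obtain m where n: "n = Suc k + m"
    using le_Suc_ex[of "Suc k" n] by auto
  have coeff: "2 * n - Suc k = k + 2 * m + 1" using n by simp
  \<comment> \<open>Every term acquires the factor \<open>fact (Suc k) * odd_dfact (Suc m)\<close>.
    For \<open>k = Suc j\<close>, what remains is Pascal's rule for
    \<open>(k + 2 * m + 2) choose k\<close>.\<close>
  have lhs: "R (Suc n) (Suc k) = fact (Suc k) * ((k + 2 * m + 2) choose k) * odd_dfact (Suc m)"
    using R_eq[of k "Suc m"] n by simp
  have snd: "(2 * n - Suc k) * R n (Suc k) =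
      fact (Suc k) * ((k + 2 * m + 1) choose k) * odd_dfact (Suc m)"
  proof -
    have "(2 * n - Suc k) * R n (Suc k) =
        fact (Suc k) * ((k + 2 * m + 1) * ((k + 2 * m) choose k)) * odd_dfact m"
      unfolding coeff unfolding n R_eq by (simp only: ac_simps)
    also have "\<dots> = fact (Suc k) * ((k + 2 * m + 1) choose k) * odd_dfact (Suc m)"
      unfolding absorption_odd[symmetric] odd_dfact_Suc by (simp only: ac_simps)
    finally show ?thesis .
  qed
  show ?thesis
  proof (cases k)
    case 0
    then show ?thesis unfolding lhs snd by simp
  next
    case (Suc j)
    have "Suc k * R n k = fact (Suc k) * ((k + 2 * m + 1) choose j) * odd_dfact (Suc m)"
      using R_eq[of j "Suc m"] n Suc by (simp add: algebra_simps)
    then show ?thesis unfolding lhs snd using Suc by (simp add: algebra_simps)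
  qed
qed

lemma derivation_add: "derivation D \<Longrightarrow> D (u + v) = D u + D v"
  by (simp add: derivation_def)

lemma derivation_mult: "derivation D \<Longrightarrow> D (u * v) = D u * v + u * D v"
  by (simp add: derivation_def)

lemma derivation_zero: "derivation D \<Longrightarrow> D 0 = 0"
  using derivation_add[of D 0 0] by simp

lemma derivation_one: "derivation D \<Longrightarrow> D 1 = 0"
  using derivation_mult[of D 1 1] by simp

lemma derivation_sum: "derivation D \<Longrightarrow> D (sum f A) = (\<Sum>x\<in>A. D (f x))"
  by (induction A rule: infinite_finite_induct) (simp_all add: derivation_zero derivation_add)

lemma derivation_of_nat: "derivation D \<Longrightarrow> D (of_nat m) = 0"
  by (induction m) (simp_all add: derivation_zero derivation_one derivation_add)

lemma derivation_power: "derivation D \<Longrightarrow> D (u ^ Suc m) = of_nat (Suc m) * u ^ m * D u"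
proof (induction m)
  case (Suc m)
  have "D (u ^ Suc (Suc m)) = D u * u ^ Suc m + u * D (u ^ Suc m)"
    using Suc.prems by (simp only: power_Suc[of u "Suc m"] derivation_mult)
  then show ?case using Suc by (simp add: algebra_simps)
qed simp

text \<open>Here \<open>w\<close> acts as a logarithmic derivative of \<open>u\<close>; keeping the
  exponent \<open>m\<close> makes the formula valid for \<open>m = 0\<close> too.\<close>

lemma derivation_power_scaled:
  assumes "derivation D" and "D u = u * w"
  shows "D (u ^ m) = of_nat m * u ^ m * w"
proof (cases m)
  case (Suc j)
  show ?thesis
    unfolding Suc derivation_power[OF assms(1)] assms(2) by (simp only: power_Suc mult_ac)
qed (simp add: derivation_one[OF assms(1)])

definition grammar_monomial :: "nat \<Rightarrow> nat \<Rightarrow> qpoly" where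
  "grammar_monomial n k = va ^ Suc k * vb ^ n * vc ^ (n - k)"

text \<open>The logarithmic derivatives of \<open>va\<close>, \<open>vb\<close>, \<open>vc\<close>
  are \<open>va * vb\<close>, \<open>vb * vc\<close>, \<open>vb * vc\<close>. The last two agree, so
  the exponents \<open>n\<close> and \<open>n - k\<close> add up to the coefficient
  \<open>2 * n - k\<close>.\<close>

lemma derivation_grammar_monomial:
  assumes D: "derivation D"
    and a: "D va = va ^ 2 * vb" and b: "D vb = vb ^ 2 * vc" and c: "D vc = vb * vc ^ 2"
    and k: "k \<le> n"
  shows "D (grammar_monomial n k) =
    of_nat (Suc k) * grammar_monomial (Suc n) (Suc k)
    + of_nat (2 * n - k) * grammar_monomial (Suc n) k"
proof -
  have "D (va ^ i) = of_nat i * va ^ i * (va * vb)" "D (vb ^ i) = of_nat i * vb ^ i * (vb * vc)"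
    "D (vc ^ i) = of_nat i * vc ^ i * (vb * vc)" for i
    by (rule derivation_power_scaled[OF D]; simp add: a b c power2_eq_square mult_ac)+
  moreover obtain m where "n = k + m" using k le_Suc_ex by blast
  moreover from this have "2 * n - k = n + m" "Suc n - k = Suc m" "n - k = m" by simp_all
  ultimately show ?thesis
    by (simp add: grammar_monomial_def derivation_mult[OF D] a power2_eq_square algebra_simps)
qed

theorem theorem3:
  fixes D :: "qpoly \<Rightarrow> qpoly" and n :: nat
  assumes "derivation D"
    and "D va = va ^ 2 * vb"
    and "D vb = vb ^ 2 * vc"
    and "D vc = vb * vc ^ 2"
    and "n \<ge> 1"
  shows "(D ^^ n) va = va * vb ^ n * (\<Sum>k = 1..n. of_nat (R n k) * va ^ k * vc ^ (n - k))"
proof -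
  let ?t = grammar_monomial
  have "(D ^^ n) va = (\<Sum>k = 1..n. of_nat (R n k) * ?t n k)"
    using \<open>n \<ge> 1\<close>
  proof (induction n rule: dec_induct)
    case base
    show ?case
      using assms(2) by (simp add: R_diag grammar_monomial_def power2_eq_square mult_ac)
  next
    case (step n)
    note n = step.hyps(1)
    let ?u = "\<lambda>k. of_nat (Suc k * R n k) * ?t (Suc n) (Suc k)"
    let ?v = "\<lambda>k. of_nat ((2 * n - k) * R n k) * ?t (Suc n) k"
    have "(D ^^ Suc n) va = (\<Sum>k = 1..n. D (of_nat (R n k) * ?t n k))"
      using step.IH by (simp add: derivation_sum[OF assms(1)])
    also have "\<dots> = (\<Sum>k = 1..n. ?u k + ?v k)"
    proof (rule sum.cong[OF refl])
      fix k assume "k \<in> {1..n}"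
      then show "D (of_nat (R n k) * ?t n k) = ?u k + ?v k"
        by (simp add: derivation_mult[OF assms(1)] derivation_of_nat[OF assms(1)]
            derivation_grammar_monomial[OF assms(1-4)] algebra_simps)
    qed
    \<comment> \<open>Both sums now run over the multiples of \<open>?t (Suc n) (Suc k)\<close>. The
      added term of the first is set to 0 by hand, since \<open>R n 0\<close> need not vanish; that
      of the second contains \<open>R n (Suc n) = 0\<close>.\<close>
    also have "\<dots> = (\<Sum>k\<le>n. if k = 0 then 0 else ?u k) + (\<Sum>k\<le>n. ?v (Suc k))"
    proof -
      have "(\<Sum>k = 1..n. ?u k) = (\<Sum>k\<le>n. if k = 0 then 0 else ?u k)"
        by (rule sum.mono_neutral_cong_left) auto
      moreover have "(\<Sum>k = 1..n. ?v k) = (\<Sum>k\<le>n. ?v (Suc k))"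
        using n by (simp add: sum.atLeast1_atMost_eq R_above_diag flip: lessThan_Suc_atMost)
      ultimately show ?thesis by (simp only: sum.distrib)
    qed
    also have "\<dots> = (\<Sum>k\<le>n. of_nat (R (Suc n) (Suc k)) * ?t (Suc n) (Suc k))"
      unfolding sum.distrib[symmetric]
    proof (rule sum.cong[OF refl])
      fix k assume "k \<in> {..n}"
      then show "(if k = 0 then 0 else ?u k) + ?v (Suc k) =
          of_nat (R (Suc n) (Suc k)) * ?t (Suc n) (Suc k)"
        using R_Suc_Suc[OF n, of k]
        by (simp only: of_nat_add distrib_right atMost_iff of_nat_0 mult_zero_left split: if_split) simp
    qed
    also have "\<dots> = (\<Sum>k = 1..Suc n. of_nat (R (Suc n) k) * ?t (Suc n) k)"
      by (simp only: One_nat_def sum.atLeast1_atMost_eq lessThan_Suc_atMost)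
    finally show ?case .
  qed
  then show ?thesis
    by (simp add: grammar_monomial_def sum_distrib_left mult_ac)
qed

end
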